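(* Let $H$ be a real Hilbert space, $T:H\to H$ a nonexpansive mapping, $(\beta_n)_{n\in\mathbb{N}},(\lambda_n)_{n\in\mathbb{N}}\subset(0,1]$, $x_0\in H$, and let $(x_n)$ be generated by $$x_{n+1}=\beta_n x_n+\lambda_n\big(T(\beta_n x_n)-\beta_n x_n\big)\qquad(n\in\mathbb{N}).$$ Assume that there exist $\ell\in\mathbb{N}\setminus\{0\}$ and monotone functions $b,D,B,L:\mathbb{N}\to\mathbb{N}$ and $h:\mathbb{N}\to\mathbb{N}\setminus\{0\}$ such that 1. $\forall n\in\mathbb{N}\ \big(\beta_n\ge \frac{1}{h(n)}\big)$; 2. $\forall k\in\mathbb{N}\ \forall n\ge b(k)\ \big(|1-\beta_n|\le\frac{1}{k+1}\big)$; 3. $\forall k\in\mathbb{N}\ \big(\sum_{i=1}^{D(k)}(1-\beta_i)\ge k\big)$; 4. $\forall k\in\mathbb{N}\ \forall n\in\mathbb{N}\ \big(\sum_{i=B(k)+1}^{B(k)+n}|\beta_i-\beta_{i-1}|\le\frac{1}{k+1}\big)$; 5. $\forall n\in\mathbb{N}\ \big(\lambda_n\ge\frac1\ell\big)$; 6. $\forall k\in\mathbb{N}\ \forall n\in\mathbb{N}\ \big(\sum_{i=L(k)+1}^{L(k)+n}|\lambda_i-\lambda_{i-1}|\le\frac{1}{k+1}\big)$. Assume that there exists $N\in\mathbb{N}\setminus\{0\}$ such that $N\ge\max\{\|x_0-p\|,\|p\|\}$ for some $p\in\mathrm{Fix}\,T$. Then for all $k\in\mathbb{N}$ and all monotone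 functions $f:\mathbb{N}\to\mathbb{N}$, $$\exists n\le\mu(k,f)\ \forall i,j\in[n,f(n)]\ \Big(\|x_i-x_j\|\le\frac{1}{k+1}\Big),$$ where $\mu(k,f)=\mu[N,\ell,b,h,D,B,L](k,f)$ is the explicit bound defined in the context.
   Context: $\mathbb{N}=\{0,1,2,\dots\}$. A function $f:\mathbb{N}\to\mathbb{N}$ is called monotone if it is nondecreasing. $\mathrm{Fix}\,T$ is the set of fixed points of $T$. $[a,c]$ denotes the integer interval (empty if $c<a$). For a function $g:\mathbb{N}\to\mathbb{N}$, $g^{(R)}$ denotes its $R$-fold iterate. Definition of $\mu[N,\ell,b,h,D,B,L]$, for $N,\ell\in\mathbb{N}\setminus\{0\}$ and monotone functions $b,D,B,L:\mathbb{N}\to\mathbb{N}$, $h:\mathbb{N}\to\mathbb{N}\setminus\{0\}$: - $G(k):=\max\{B(4N(k+1)-1),\,L(10N(k+1)-1)\}$. - $\nu_1(k):=D\big(M-1+\lceil\ln(6N(k+1))\rceil\big)+1$, where $M:=\max\{0,\,G(3k+2)+1\}$. - $\nu_2(k):=\max\{b(4N\ell(k+1)-1),\,\nu_1(2\ell(k+1)-1)\}$. - For $k\in\mathbb{N}$ and monotone $f:\mathbb{N}\to\mathbb{N}$: $\psi(k,f):=\nu_2\big(48N(\check g^{(R)}(0)+1)^2\big)$, where $g(m):=f(\nu_2(m))$, $R:=64N^4(k+1)^2$ and $\check g(m):=\max\{g(48N(m+1)^2),\,48N(m+1)^2\}$. - $\sigma(k,n):=D\big(n+\lceil\ln(27N^2(k+1))\rceil\big)+1$.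 - Given $k$ and $f$: $\widetilde k:=4(k+1)^2-1$, $n_1:=b(54N^2(\widetilde k+1)-1)$, $\overline f(m):=f\big(\sigma(\widetilde k,\max\{m,n_1\})\big)$, $\widetilde f(m):=3(10N+1)(\widetilde k+1)(\overline f(m)+1)\,h(\overline f(m))-1$. - $\mu(k,f):=\sigma\big(\widetilde k,\max\{\psi(12(\widetilde k+1)-1,\widetilde f),\,n_1\}\big)$. *)

theory Defs
  imports "HOL-Analysis.Analysis"
begin

definition Fix :: "('a \<Rightarrow> 'a) \<Rightarrow> 'a set" where
  "Fix T = {p. T p = p}"

text \<open>
  The functions below make up the bound \<open>\<mu>[N, \<ell>, b, h, D, B, L]\<close>. They are meant for \<open>N > 0\<close>, \<open>\<ell> > 0\<close>,
  \<open>h\<close> with values \<open>> 0\<close> and monotone function arguments. Under these assumptions every subtraction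
  on \<^typ>\<open>nat\<close> below has a subtrahend at most its minuend, so that none is truncated, and every
  argument of \<^const>\<open>ln\<close> is at least 6, so that \<^const>\<open>nat\<close> is applied only to positive integers.
\<close>

definition tikh_G :: "nat \<Rightarrow> (nat \<Rightarrow> nat) \<Rightarrow> (nat \<Rightarrow> nat) \<Rightarrow> nat \<Rightarrow> nat" where
  "tikh_G N B L k = max (B (4 * N * (k + 1) - 1)) (L (10 * N * (k + 1) - 1))"

definition tikh_nu1 :: "nat \<Rightarrow> (nat \<Rightarrow> nat) \<Rightarrow> (nat \<Rightarrow> nat) \<Rightarrow> (nat \<Rightarrow> nat) \<Rightarrow> nat \<Rightarrow> nat" where
  "tikh_nu1 N D B L k =
     (let M = max 0 (tikh_G N B L (3 * k + 2) + 1)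
      in D (M - 1 + nat \<lceil>ln (real (6 * N * (k + 1)))\<rceil>) + 1)"

definition tikh_nu2 ::
  "nat \<Rightarrow> nat \<Rightarrow> (nat \<Rightarrow> nat) \<Rightarrow> (nat \<Rightarrow> nat) \<Rightarrow> (nat \<Rightarrow> nat) \<Rightarrow> (nat \<Rightarrow> nat) \<Rightarrow> nat \<Rightarrow> nat" where
  "tikh_nu2 N l b D B L k =
     max (b (4 * N * l * (k + 1) - 1)) (tikh_nu1 N D B L (2 * l * (k + 1) - 1))"

definition tikh_psi ::
  "nat \<Rightarrow> nat \<Rightarrow> (nat \<Rightarrow> nat) \<Rightarrow> (nat \<Rightarrow> nat) \<Rightarrow> (nat \<Rightarrow> nat) \<Rightarrow> (nat \<Rightarrow> nat)
    \<Rightarrow> nat \<Rightarrow> (nat \<Rightarrow> nat) \<Rightarrow> nat" where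
  "tikh_psi N l b D B L k f =
     (let \<nu>\<^sub>2 = tikh_nu2 N l b D B L;
          R = 64 * N ^ 4 * (k + 1)\<^sup>2;
          g = (\<lambda>m. f (\<nu>\<^sub>2 m));
          g_check = (\<lambda>m. max (g (48 * N * (m + 1)\<^sup>2)) (48 * N * (m + 1)\<^sup>2))
      in \<nu>\<^sub>2 (48 * N * ((g_check ^^ R) 0 + 1)\<^sup>2))"

definition tikh_sigma :: "nat \<Rightarrow> (nat \<Rightarrow> nat) \<Rightarrow> nat \<Rightarrow> nat \<Rightarrow> nat" where
  "tikh_sigma N D k n = D (n + nat \<lceil>ln (real (27 * N\<^sup>2 * (k + 1)))\<rceil>) + 1"

definition tikh_mu ::
  "nat \<Rightarrow> nat \<Rightarrow> (nat \<Rightarrow> nat) \<Rightarrow> (nat \<Rightarrow> nat) \<Rightarrow> (nat \<Rightarrow> nat) \<Rightarrow> (nat \<Rightarrow> nat) \<Rightarrow> (nat \<Rightarrow> nat)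
    \<Rightarrow> nat \<Rightarrow> (nat \<Rightarrow> nat) \<Rightarrow> nat" where
  "tikh_mu N l b h D B L k f =
     (let k_tilde = 4 * (k + 1)\<^sup>2 - 1;
          n\<^sub>1 = b (54 * N\<^sup>2 * (k_tilde + 1) - 1);
          f_bar = (\<lambda>m. f (tikh_sigma N D k_tilde (max m n\<^sub>1)));
          f_tilde = (\<lambda>m. 3 * (10 * N + 1) * (k_tilde + 1) * (f_bar m + 1) * h (f_bar m) - 1)
      in tikh_sigma N D k_tilde
           (max (tikh_psi N l b D B L (12 * (k_tilde + 1) - 1) f_tilde) n\<^sub>1))"

end

theory Submission
  imports Defs
begin

text \<open>
  All iterates stay in the ball of radius \<open>N\<close> around \<open>p\<close>, and a recursive inequality of Xu's type makes
  them asymptotically regular with rate \<open>\<nu>\<^sub>2\<close>. Instead of the fixed point of least norm, which comes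
  without a rate, one takes an approximate fixed point \<open>u\<close> in that ball whose squared norm is minimal up
  to \<open>\<epsilon> = 1 / (64 N\<^sup>2 (k + 1)\<^sup>2)\<close> among the fixed points of a coarser precision: were there none
  for any of the \<open>R\<close> precisions \<open>g_check ^^ i\<close>, the squared norm would drop \<open>R\<close> times by more than
  \<open>\<epsilon>\<close>, starting from \<open>\<parallel>p\<parallel>\<^sup>2 \<le> N\<^sup>2 = R \<epsilon>\<close>. Approximate fixed points being approximately convex,
  \<open>u\<close> satisfies an approximate variational inequality along the iteration, and the recursive
  inequality for \<open>\<parallel>x\<^sub>n - u\<parallel>\<^sup>2\<close> brings \<open>x\<^sub>n\<close> close to \<open>u\<close> on the whole interval.
\<close>

section \<open>Approximate fixed points, recursive inequalities, approximate minimizers\<close>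

text \<open>For the convex combination \<open>w\<close>, the squared distance from
  \<open>T w\<close> to \<open>w\<close> is expressed exactly by those from \<open>T w\<close> to
  \<open>u\<close> and \<open>v\<close>, minus \<open>t * (1 - t) * e\<^sup>2\<close>. After
  inserting the bounds on the latter two, the terms of order \<open>e\<^sup>2\<close> cancel, and
  what remains is of order \<delta>. The estimate concerns a square, so precision is lost by a
  square root.\<close>

lemma approx_fixpoint_convex:
  fixes T :: "'a::real_inner \<Rightarrow> 'a"
  assumes T: "\<And>u v. norm (T u - T v) \<le> norm (u - v)"
    and t: "0 \<le> t" "t \<le> 1"
    and u: "norm (T u - u) \<le> \<delta>" and v: "norm (T v - v) \<le> \<delta>"
    and d: "norm (u - v) \<le> d"
  shows "(norm (T ((1 - t) *\<^sub>R u + t *\<^sub>R v) - ((1 - t) *\<^sub>R u + t *\<^sub>R v)))\<^sup>2 \<le> d * \<delta> + \<delta>\<^sup>2"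
proof -
  define w where "w = (1 - t) *\<^sub>R u + t *\<^sub>R v"
  define e where "e = norm (u - v)"
  have \<delta>: "\<delta> \<ge> 0" using norm_ge_zero u by (rule order_trans)
  have e: "0 \<le> e" "e \<le> d" using d by (auto simp: e_def)
  have "w - u = t *\<^sub>R (v - u)" "w - v = (1 - t) *\<^sub>R (u - v)"
    by (simp_all add: w_def algebra_simps)
  hence "norm (w - u) = t * e" "norm (w - v) = (1 - t) * e"
    using t by (simp_all add: e_def norm_minus_commute)
  hence "norm (T w - u) \<le> t * e + \<delta>" "norm (T w - v) \<le> (1 - t) * e + \<delta>"
    using T[of w u] T[of w v] u v norm_triangle_ineq[of "T w - T u" "T u - u"]
      norm_triangle_ineq[of "T w - T v" "T v - v"] by auto
  hence sq: "(norm (T w - u))\<^sup>2 \<le> (t * e + \<delta>)\<^sup>2" "(norm (T w - v))\<^sup>2 \<le> ((1 - t) * e + \<delta>)\<^sup>2"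
    by (auto intro: power_mono)
  have "(norm (T w - w))\<^sup>2
      = (1 - t) * (norm (T w - u))\<^sup>2 + t * (norm (T w - v))\<^sup>2 - t * (1 - t) * e\<^sup>2"
    unfolding w_def[symmetric] e_def power2_norm_eq_inner
    unfolding w_def by (simp add: inner_diff_left inner_diff_right inner_add_left inner_add_right
        inner_commute algebra_simps)
  also have "\<dots> \<le> (1 - t) * (t * e + \<delta>)\<^sup>2 + t * ((1 - t) * e + \<delta>)\<^sup>2 - t * (1 - t) * e\<^sup>2"
    using mult_left_mono[OF sq(1), of "1 - t"] mult_left_mono[OF sq(2), of t] t by simp
  also have "\<dots> = (4 * t * (1 - t)) * (e * \<delta>) + \<delta>\<^sup>2"
    by (simp add: power2_eq_square algebra_simps)
  also have "(4 * t * (1 - t)) * (e * \<delta>) \<le> 1 * (d * \<delta>)"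
  proof (rule mult_mono)
    have "1 - 4 * t * (1 - t) = (1 - 2 * t)\<^sup>2" by (simp add: power2_eq_square algebra_simps)
    thus "4 * t * (1 - t) \<le> 1" using zero_le_power2[of "1 - 2 * t"] by linarith
  qed (use e \<delta> in \<open>auto intro: mult_right_mono\<close>)
  finally show ?thesis by (simp add: w_def)
qed

text \<open>Each step forms a convex combination of the previous bound with \<open>c\<close>, so
  \<open>c\<close> reproduces itself, the factors \<open>a i\<close> damp only the initial value,
  and the errors at worst add up.\<close>

lemma xu_inequality:
  fixes s a e :: "nat \<Rightarrow> real"
  assumes "m \<le> q" and "c \<ge> 0"
    and a: "\<And>i. 0 \<le> a i" "\<And>i. a i \<le> 1" and e: "\<And>i. 0 \<le> e i"
    and step: "\<And>i. m \<le> i \<Longrightarrow> i < q \<Longrightarrow> s (Suc i) \<le> a i * s i + (1 - a i) * c + e i"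
  shows "s q \<le> (\<Prod>i=m..<q. a i) * s m + c + (\<Sum>i=m..<q. e i)"
  using \<open>m \<le> q\<close> step
proof (induction q rule: dec_induct)
  case base
  then show ?case using \<open>c \<ge> 0\<close> by simp
next
  case (step q)
  have E: "(\<Sum>i=m..<q. e i) \<ge> 0" by (simp add: e sum_nonneg)
  have "s (Suc q) \<le> a q * s q + (1 - a q) * c + e q" using step by simp
  also have "a q * s q \<le> a q * ((\<Prod>i=m..<q. a i) * s m + c + (\<Sum>i=m..<q. e i))"
    using step by (intro mult_left_mono a) auto
  also have "a q * ((\<Prod>i=m..<q. a i) * s m + c + (\<Sum>i=m..<q. e i)) + (1 - a q) * c + e q
      = (\<Prod>i=m..<Suc q. a i) * s m + c + (a q * (\<Sum>i=m..<q. e i) + e q)"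
    using step.hyps by (simp add: algebra_simps)
  also have "a q * (\<Sum>i=m..<q. e i) \<le> (\<Sum>i=m..<q. e i)"
    using mult_right_mono[OF a(2)[of q] E] by simp
  finally show ?case using step.hyps by simp
qed

text \<open>Moving from \<open>u\<close> towards \<open>y\<close> by a fraction \<open>t\<close>
  lowers the squared norm by at most \<epsilon>; expand the square and divide by \<open>t\<close>.
  This is the quantitative form of the variational inequality for the projection of 0.\<close>

lemma approx_minimizer_variational:
  fixes u y :: "'a::real_inner"
  assumes t: "0 < t"
    and min: "(norm u)\<^sup>2 \<le> (norm ((1 - t) *\<^sub>R u + t *\<^sub>R y))\<^sup>2 + \<epsilon>"
    and d: "norm (y - u) \<le> d"
  shows "2 * (u \<bullet> (u - y)) \<le> t * d\<^sup>2 + \<epsilon> / t"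
proof -
  have "(norm ((1 - t) *\<^sub>R u + t *\<^sub>R y))\<^sup>2 = (norm u)\<^sup>2 - 2 * t * (u \<bullet> (u - y)) + t\<^sup>2 * (norm (y - u))\<^sup>2"
    unfolding power2_norm_eq_inner
    by (simp add: inner_diff_left inner_diff_right inner_add_left inner_add_right
        inner_commute algebra_simps power2_eq_square)
  moreover have "t\<^sup>2 * (norm (y - u))\<^sup>2 \<le> t\<^sup>2 * d\<^sup>2"
    using d by (intro mult_left_mono power_mono) auto
  ultimately have "2 * t * (u \<bullet> (u - y)) \<le> t\<^sup>2 * d\<^sup>2 + \<epsilon>"
    using min by linarith
  also have "\<dots> = t * (t * d\<^sup>2 + \<epsilon> / t)"
    using t by (simp add: distrib_left power2_eq_square)
  finally have "t * (2 * (u \<bullet> (u - y))) \<le> t * (t * d\<^sup>2 + \<epsilon> / t)"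
    by (simp add: mult_ac)
  thus ?thesis using t by simp
qed

text \<open>The descent runs from the finest set \<open>F (r R)\<close> down to the coarsest \<open>F (r 0)\<close>.\<close>

lemma exists_approx_minimizer:
  fixes \<phi> :: "'a \<Rightarrow> real" and F :: "nat \<Rightarrow> 'a set"
  assumes p: "p \<in> F (r R)" "\<phi> p \<le> real R * \<epsilon>"
    and nonneg: "\<And>u. \<phi> u \<ge> 0" and "R > 0"
  shows "\<exists>i<R. \<exists>u\<in>F (r (Suc i)). \<forall>y\<in>F (r i). \<phi> u \<le> \<phi> y + \<epsilon>"
proof (rule ccontr)
  assume neg: "\<not> ?thesis"
  \<comment> \<open>The strict inequality for \<open>j > 0\<close> matters only at
    \<open>j = R\<close>, where the bound is 0 and contradicts nonnegativity.\<close>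
  have "\<exists>u\<in>F (r (R - j)). \<phi> u \<le> (real R - real j) * \<epsilon> \<and> (j > 0 \<longrightarrow> \<phi> u < (real R - real j) * \<epsilon>)"
    if "j \<le> R" for j
    using that
  proof (induction j)
    case 0
    then show ?case using p by auto
  next
    case (Suc j)
    then obtain u where u: "u \<in> F (r (R - j))" "\<phi> u \<le> (real R - real j) * \<epsilon>" by auto
    have "Suc (R - Suc j) = R - j" "R - Suc j < R" using Suc.prems by auto
    then obtain y where "y \<in> F (r (R - Suc j))" "\<phi> y + \<epsilon> < \<phi> u"
      using neg u(1) by (metis not_le)
    with u(2) show ?case by (intro bexI[of _ y]) (auto simp: algebra_simps)
  qed
  from this[of R] \<open>R > 0\<close> show False using nonneg by (auto simp: not_less[symmetric])
qed

section \<open>The iteration and its boundedness\<close>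

locale tikhonov_mann =
  fixes T :: "'a::real_inner \<Rightarrow> 'a"
    and \<beta> lam :: "nat \<Rightarrow> real"
    and x :: "nat \<Rightarrow> 'a"
    and p :: 'a
    and N l :: nat
    and b D B L :: "nat \<Rightarrow> nat"
  assumes T: "norm (T u - T v) \<le> norm (u - v)"
    and \<beta>_pos: "0 < \<beta> n" and \<beta>_le: "\<beta> n \<le> 1"
    and lam_pos: "0 < lam n" and lam_le: "lam n \<le> 1"
    and x_Suc: "x (Suc n) = \<beta> n *\<^sub>R x n + lam n *\<^sub>R (T (\<beta> n *\<^sub>R x n) - \<beta> n *\<^sub>R x n)"
    and l_pos: "l > 0"
    and mono: "mono b" "mono D" "mono B" "mono L"
    and b: "n \<ge> b k \<Longrightarrow> 1 - \<beta> n \<le> 1 / (real k + 1)"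
    and D: "(\<Sum>i=1..D k. 1 - \<beta> i) \<ge> real k"
    and B: "(\<Sum>i=B k + 1..B k + n. \<bar>\<beta> i - \<beta> (i - 1)\<bar>) \<le> 1 / (real k + 1)"
    and lam_ge: "lam n \<ge> 1 / real l"
    and L: "(\<Sum>i=L k + 1..L k + n. \<bar>lam i - lam (i - 1)\<bar>) \<le> 1 / (real k + 1)"
    and N_pos: "N > 0"
    and p: "T p = p" "norm (x 0 - p) \<le> N" "norm p \<le> N"
begin

abbreviation y :: "nat \<Rightarrow> 'a" where "y n \<equiv> \<beta> n *\<^sub>R x n"

text \<open>The Mann step: one iteration first shrinks \<open>x n\<close> towards the origin to
  \<open>y n\<close> and then applies the averaged map \<open>S n\<close>.\<close>

definition S :: "nat \<Rightarrow> 'a \<Rightarrow> 'a" where "S n v = (1 - lam n) *\<^sub>R v + lam n *\<^sub>R T v"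

lemma x_Suc_S: "x (Suc n) = S n (y n)"
  unfolding S_def x_Suc[of n] by (simp add: algebra_simps)

lemma S_nonexpansive: "norm (S n u - S n v) \<le> norm (u - v)"
proof -
  have "S n u - S n v = (1 - lam n) *\<^sub>R (u - v) + lam n *\<^sub>R (T u - T v)"
    by (simp add: S_def algebra_simps)
  also have "norm \<dots> \<le> (1 - lam n) * norm (u - v) + lam n * norm (T u - T v)"
    using norm_triangle_ineq[of "(1 - lam n) *\<^sub>R (u - v)" "lam n *\<^sub>R (T u - T v)"]
      lam_pos[of n] lam_le[of n] by simp
  also have "lam n * norm (T u - T v) \<le> lam n * norm (u - v)"
    using lam_pos[of n] by (intro mult_left_mono T) auto
  finally show ?thesis by (simp add: algebra_simps)
qed

lemma S_minus: "S n v - v = lam n *\<^sub>R (T v - v)"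
  by (simp add: S_def algebra_simps)

text \<open>The point \<open>y n\<close> lies on the segment from 0 to \<open>x n\<close>, and the
  bound on \<open>norm p\<close> says that 0 belongs to the ball around \<open>p\<close> as
  well.\<close>

lemma y_ball_step:
  assumes "norm (x n - p) \<le> N"
  shows "norm (y n - p) \<le> N"
proof -
  have "y n - p = \<beta> n *\<^sub>R (x n - p) - (1 - \<beta> n) *\<^sub>R p" by (simp add: algebra_simps)
  hence "norm (y n - p) \<le> \<beta> n * norm (x n - p) + (1 - \<beta> n) * norm p"
    using norm_triangle_ineq4[of "\<beta> n *\<^sub>R (x n - p)" "(1 - \<beta> n) *\<^sub>R p"]
      \<beta>_pos[of n] \<beta>_le[of n] by simp
  also have "\<dots> \<le> \<beta> n * N + (1 - \<beta> n) * N"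
    using assms p(3) \<beta>_pos[of n] \<beta>_le[of n] by (intro add_mono mult_left_mono) auto
  finally show ?thesis by (simp add: algebra_simps)
qed

lemma x_ball: "norm (x n - p) \<le> N"
proof (induction n)
  case 0
  then show ?case by (rule p(2))
next
  case (Suc n)
  have "S n p = p" by (simp add: S_def p(1) algebra_simps)
  hence "norm (x (Suc n) - p) \<le> norm (y n - p)"
    using S_nonexpansive[of n "y n" p] by (simp add: x_Suc_S)
  with y_ball_step[OF Suc] show ?case by linarith
qed

lemma y_ball: "norm (y n - p) \<le> N"
  by (rule y_ball_step[OF x_ball])

lemma norm_x_le: "norm (x n) \<le> 2 * N"
  using norm_triangle_ineq[of "x n - p" p] x_ball[of n] p(3) by simp

lemma ball_diam:
  assumes "norm (u - p) \<le> N" "norm (v - p) \<le> N"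
  shows "norm (u - v) \<le> 2 * N"
  using norm_triangle_ineq4[of "u - p" "v - p"] assms by simp

lemma T_ball: "norm (v - p) \<le> N \<Longrightarrow> norm (T v - p) \<le> N"
  using T[of v p] p(1) by simp

section \<open>Asymptotic regularity\<close>

text \<open>Pass from \<open>S n (y n)\<close> to \<open>S (Suc n) (y (Suc n))\<close> by changing
  first the parameter and then the point. The second change is controlled by nonexpansiveness;
  splitting the difference of the \<open>y\<close> in the same way produces the contraction
  factor.\<close>

lemma x_diff_step:
  "norm (x (Suc (Suc n)) - x (Suc n)) \<le> \<beta> (Suc n) * norm (x (Suc n) - x n)
    + 2 * N * (\<bar>\<beta> (Suc n) - \<beta> n\<bar> + \<bar>lam (Suc n) - lam n\<bar>)"
proof -
  have "x (Suc (Suc n)) - x (Suc n)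
      = (S (Suc n) (y (Suc n)) - S (Suc n) (y n)) + (lam (Suc n) - lam n) *\<^sub>R (T (y n) - y n)"
    unfolding x_Suc_S by (simp add: S_def algebra_simps)
  hence "norm (x (Suc (Suc n)) - x (Suc n))
      \<le> norm (y (Suc n) - y n) + \<bar>lam (Suc n) - lam n\<bar> * norm (T (y n) - y n)"
    by (metis (no_types) norm_triangle_le norm_scaleR S_nonexpansive add_right_mono)
  also have "y (Suc n) - y n = \<beta> (Suc n) *\<^sub>R (x (Suc n) - x n) + (\<beta> (Suc n) - \<beta> n) *\<^sub>R x n"
    by (simp add: algebra_simps)
  hence "norm (y (Suc n) - y n) \<le> \<beta> (Suc n) * norm (x (Suc n) - x n) + \<bar>\<beta> (Suc n) - \<beta> n\<bar> * norm (x n)"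
    using norm_triangle_ineq[of "\<beta> (Suc n) *\<^sub>R (x (Suc n) - x n)" "(\<beta> (Suc n) - \<beta> n) *\<^sub>R x n"]
      \<beta>_pos[of "Suc n"] by simp
  also have "\<bar>\<beta> (Suc n) - \<beta> n\<bar> * norm (x n) \<le> \<bar>\<beta> (Suc n) - \<beta> n\<bar> * (2 * N)"
    by (intro mult_left_mono norm_x_le) auto
  also have "\<bar>lam (Suc n) - lam n\<bar> * norm (T (y n) - y n) \<le> \<bar>lam (Suc n) - lam n\<bar> * (2 * N)"
    by (intro mult_left_mono ball_diam T_ball y_ball) auto
  finally show ?thesis by (simp add: algebra_simps)
qed

text \<open>Since \<open>\<beta> i \<le> exp (- (1 - \<beta> i))\<close>, a large sum makes the
  product small. The divergence rate yields a sum of at least \<open>m + ln K\<close> up to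
  \<open>n\<close>; every summand is at most 1, so the first \<open>m\<close> use up at most
  \<open>m\<close> of it, and \<open>m \<le> n\<close>.\<close>

lemma prod_\<beta>_le:
  assumes "K \<ge> 1" and n: "n \<ge> D (m + nat \<lceil>ln K\<rceil>)"
  shows "m \<le> n" and "(\<Prod>i=Suc m..<Suc n. \<beta> i) \<le> 1 / K"
proof -
  define j where "j = m + nat \<lceil>ln K\<rceil>"
  have "real j \<le> (\<Sum>i=1..D j. 1 - \<beta> i)" by (rule D)
  also have "\<dots> \<le> (\<Sum>i=1..n. 1 - \<beta> i)"
    using n by (intro sum_mono2) (auto simp: j_def \<beta>_le)
  finally have j: "real j \<le> (\<Sum>i=1..n. 1 - \<beta> i)" .
  have le: "(\<Sum>i=1..q. 1 - \<beta> i) \<le> q" for q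
    using sum_mono[of "{1..q}" "\<lambda>i. 1 - \<beta> i" "\<lambda>_. 1"] \<beta>_pos by (simp add: less_imp_le)
  show "m \<le> n" using j le[of n] by (simp add: j_def)
  hence "(\<Sum>i=1..n. 1 - \<beta> i) = (\<Sum>i=1..m. 1 - \<beta> i) + (\<Sum>i=Suc m..<Suc n. 1 - \<beta> i)"
    using sum.atLeastLessThan_concat[of 1 "Suc m" "Suc n" "\<lambda>i. 1 - \<beta> i"]
    by (simp add: atLeastLessThanSuc_atLeastAtMost[symmetric] del: sum.op_ivl_Suc)
  moreover have "real j \<ge> m + ln K" using real_nat_ceiling_ge[of "ln K"] by (simp add: j_def)
  ultimately have ln: "ln K \<le> (\<Sum>i=Suc m..<Suc n. 1 - \<beta> i)"
    using j le[of m] by linarith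
  have "(\<Prod>i=Suc m..<Suc n. \<beta> i) \<le> (\<Prod>i=Suc m..<Suc n. exp (- (1 - \<beta> i)))"
  proof (rule prod_mono, intro conjI)
    fix i
    show "0 \<le> \<beta> i" using \<beta>_pos[of i] by simp
    show "\<beta> i \<le> exp (- (1 - \<beta> i))" using exp_ge_add_one_self[of "- (1 - \<beta> i)"] by simp
  qed
  also have "\<dots> = exp (- (\<Sum>i=Suc m..<Suc n. 1 - \<beta> i))"
    by (simp only: exp_sum[symmetric] sum_negf finite_atLeastLessThan)
  also have "\<dots> \<le> exp (- ln K)" using ln by simp
  also have "\<dots> = 1 / K" using \<open>K \<ge> 1\<close> by (simp add: exp_minus inverse_eq_divide)
  finally show "(\<Prod>i=Suc m..<Suc n. \<beta> i) \<le> 1 / K" .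
qed

abbreviation G where "G \<equiv> tikh_G N B L"
abbreviation \<nu>1 where "\<nu>1 \<equiv> tikh_nu1 N D B L"
abbreviation \<nu>2 where "\<nu>2 \<equiv> tikh_nu2 N l b D B L"

text \<open>As \<open>G k\<close> dominates both Cauchy moduli, the two tails contribute 1/2 and 1/5
  of the target after multiplication by \<open>2 * N\<close>.\<close>

lemma variation_le:
  assumes "G k \<le> q"
  shows "(\<Sum>i=G k..<q. 2 * N * (\<bar>\<beta> (Suc i) - \<beta> i\<bar> + \<bar>lam (Suc i) - lam i\<bar>)) \<le> 1 / (real k + 1)"
proof -
  have tail: "(\<Sum>i=G k..<q. \<bar>a (Suc i) - a i\<bar>) \<le> 1 / (real j + 1)"
    if A: "\<And>n. (\<Sum>i=A + 1..A + n. \<bar>a i - a (i - 1)\<bar>) \<le> 1 / (real j + 1)" and le: "A \<le> G k"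
    for a :: "nat \<Rightarrow> real" and A j
  proof -
    have "(\<Sum>i=G k..<q. \<bar>a (Suc i) - a i\<bar>) = (\<Sum>i=Suc (G k)..<Suc q. \<bar>a i - a (i - 1)\<bar>)"
      by (simp only: sum.shift_bounds_Suc_ivl) simp
    also have "\<dots> \<le> (\<Sum>i=A + 1..A + (q - A). \<bar>a i - a (i - 1)\<bar>)"
      using le assms by (intro sum_mono2) auto
    finally show ?thesis using A[of "q - A"] by linarith
  qed
  \<comment> \<open>A modulus at argument \<open>j\<close> gives precision
    \<open>1 / (j + 1)\<close>; the subtracted 1 turns this into an exact denominator.\<close>
  have pred: "real (c * N * (k + 1) - 1) + 1 = c * (N * (real k + 1))" if "c > 0" for c :: nat
    using that N_pos by (subst of_nat_diff) (auto simp: algebra_simps Suc_le_eq)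
  have "(\<Sum>i=G k..<q. \<bar>\<beta> (Suc i) - \<beta> i\<bar>) \<le> 1 / (4 * (N * (real k + 1)))"
    using tail[OF B, of "4 * N * (k + 1) - 1"] pred[of 4] by (simp add: tikh_G_def)
  moreover have "(\<Sum>i=G k..<q. \<bar>lam (Suc i) - lam i\<bar>) \<le> 1 / (10 * (N * (real k + 1)))"
    using tail[OF L, of "10 * N * (k + 1) - 1"] pred[of 10] by (simp add: tikh_G_def)
  ultimately have "2 * N * ((\<Sum>i=G k..<q. \<bar>\<beta> (Suc i) - \<beta> i\<bar>) + (\<Sum>i=G k..<q. \<bar>lam (Suc i) - lam i\<bar>))
      \<le> 2 * N * (1 / (4 * (N * (real k + 1))) + 1 / (10 * (N * (real k + 1))))"
    by (intro mult_left_mono add_mono) auto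
  also have "\<dots> = 7 / 10 * (1 / (real k + 1))"
  proof -
    define A where "A = real k + 1"
    have "A > 0" by (simp add: A_def)
    thus ?thesis unfolding A_def[symmetric] using N_pos by (simp add: field_simps)
  qed
  also have "\<dots> \<le> 1 * (1 / (real k + 1))" by (intro mult_right_mono) auto
  finally show ?thesis by (simp only: sum_distrib_left[symmetric] sum.distrib mult_1)
qed

lemma asymptotic_regularity:
  assumes "n \<ge> \<nu>1 k"
  shows "norm (x (Suc n) - x n) \<le> 1 / (real k + 1)"
proof -
  define m where "m = G (3 * k + 2)"
  \<comment> \<open>Chosen so that the damped initial difference, at most \<open>2 * N / K\<close>,
    is one third of the target; the argument \<open>3 * k + 2\<close> of \<open>G\<close> allots
    another third to the variation.\<close>
  define K where "K = real (6 * N * (k + 1))"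
  have K: "K \<ge> 1" using N_pos by (simp add: K_def Suc_le_eq del: of_nat_mult)
  have K_eq: "K = 6 * (N * (real k + 1))" by (simp add: K_def algebra_simps)
  have "n \<ge> D (m + nat \<lceil>ln K\<rceil>)"
    using assms by (simp add: tikh_nu1_def m_def K_def)
  note P = prod_\<beta>_le[OF K this]
  have "norm (x (Suc n) - x n) \<le> (\<Prod>i=m..<n. \<beta> (Suc i)) * norm (x (Suc m) - x m) + 0
      + (\<Sum>i=m..<n. 2 * N * (\<bar>\<beta> (Suc i) - \<beta> i\<bar> + \<bar>lam (Suc i) - lam i\<bar>))"
    by (rule xu_inequality[where s = "\<lambda>i. norm (x (Suc i) - x i)"])
      (use P(1) x_diff_step \<beta>_le in \<open>auto simp: less_imp_le[OF \<beta>_pos]\<close>)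
  also have "(\<Prod>i=m..<n. \<beta> (Suc i)) = (\<Prod>i=Suc m..<Suc n. \<beta> i)"
    by (rule prod.shift_bounds_Suc_ivl[symmetric])
  also have "(\<Prod>i=Suc m..<Suc n. \<beta> i) * norm (x (Suc m) - x m) \<le> 1 / K * (2 * N)"
    using P(2) K by (intro mult_mono ball_diam x_ball) auto
  also have "1 / K * (2 * N) = 1 / 3 * (1 / (real k + 1))"
    using N_pos unfolding K_eq by (simp del: distrib_left_numeral)
  also have "(\<Sum>i=m..<n. 2 * N * (\<bar>\<beta> (Suc i) - \<beta> i\<bar> + \<bar>lam (Suc i) - lam i\<bar>)) \<le> 1 / 3 * (1 / (real k + 1))"
    using variation_le[of "3 * k + 2" n] P(1) by (simp add: m_def algebra_simps)
  finally have "norm (x (Suc n) - x n) \<le> 2 / 3 * (1 / (real k + 1))" by simp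
  also have "\<dots> \<le> 1 * (1 / (real k + 1))" by (intro mult_right_mono) auto
  finally show ?thesis by simp
qed

text \<open>The residual at \<open>y n\<close> scaled by \<open>lam n\<close> is the distance from
  \<open>x (Suc n)\<close> to \<open>y n\<close>, which is at most the step length plus
  \<open>(1 - \<beta> n) * norm (x n)\<close>. Each summand gets half of
  \<open>1 / (l * (k + 1))\<close>, and \<open>lam n \<ge> 1 / l\<close> removes the factor.\<close>

lemma approx_fixpoint_y:
  assumes n: "n \<ge> \<nu>2 k"
  shows "norm (T (y n) - y n) \<le> 1 / (real k + 1)"
proof -
  have pred: "real (c * (k + 1) - 1) + 1 = c * (real k + 1)" if "c > 0" for c :: nat
    using that by (subst of_nat_diff) (auto simp: algebra_simps Suc_le_eq)
  have nb: "n \<ge> b (4 * N * l * (k + 1) - 1)" and n1: "n \<ge> \<nu>1 (2 * l * (k + 1) - 1)"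
    using n by (simp_all add: tikh_nu2_def)
  have "norm (x (Suc n) - x n) \<le> 1 / (2 * l * (real k + 1))"
    using asymptotic_regularity[OF n1] pred[of "2 * l"] l_pos by (simp add: mult.assoc)
  moreover have "1 - \<beta> n \<le> 1 / (4 * N * l * (real k + 1))"
    using b[OF nb] pred[of "4 * N * l"] l_pos N_pos by simp
  hence "(1 - \<beta> n) * norm (x n) \<le> 1 / (4 * N * l * (real k + 1)) * (2 * N)"
    using norm_x_le[of n] by (intro mult_mono) auto
  hence "(1 - \<beta> n) * norm (x n) \<le> 1 / (2 * l * (real k + 1))"
    using N_pos by simp
  moreover have "1 / (2 * l * (real k + 1)) = 1 / 2 * (1 / l * (1 / (real k + 1)))" by simp
  ultimately have sum: "norm (x (Suc n) - x n) + (1 - \<beta> n) * norm (x n) \<le> 1 / l * (1 / (real k + 1))"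
    by linarith
  have yx: "norm (x n - y n) = (1 - \<beta> n) * norm (x n)"
  proof -
    have "x n - y n = (1 - \<beta> n) *\<^sub>R x n" by (simp add: algebra_simps)
    thus ?thesis using \<beta>_le[of n] by simp
  qed
  have "1 / l * norm (T (y n) - y n) \<le> lam n * norm (T (y n) - y n)"
    using lam_ge[of n] by (intro mult_right_mono) auto
  also have "\<dots> = norm (x (Suc n) - y n)" using lam_pos[of n] by (simp add: S_minus x_Suc_S)
  also have "\<dots> \<le> norm (x (Suc n) - x n) + norm (x n - y n)"
    using norm_triangle_ineq[of "x (Suc n) - x n" "x n - y n"] by simp
  finally have "1 / l * norm (T (y n) - y n) \<le> 1 / l * (1 / (real k + 1))" using sum yx by linarith
  moreover have "0 < 1 / real l" using l_pos by simp
  ultimately show ?thesis by (simp only: mult_le_cancel_left_pos)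
qed

section \<open>Approximate projection of the origin\<close>

text \<open>Used to bound the rate at an unknown precision by its value at the largest precision
  that can occur.\<close>

lemma mono_\<nu>2: "mono \<nu>2"
proof
  fix j k :: nat
  assume jk: "j \<le> k"
  have G: "mono G"
    by (intro monoI) (simp only: tikh_G_def, intro max.mono monoD[OF mono(3)] monoD[OF mono(4)]
        diff_le_mono mult_le_mono add_mono order_refl)
  have "mono \<nu>1"
  proof
    fix j k :: nat
    assume "j \<le> k"
    have "6 * N * (j + 1) \<le> 6 * N * (k + 1)" "0 < 6 * N * (j + 1)"
      using N_pos \<open>j \<le> k\<close> by simp_all
    hence "ln (real (6 * N * (j + 1))) \<le> ln (real (6 * N * (k + 1)))"
      by (intro ln_mono) (simp_all only: of_nat_le_iff of_nat_0_less_iff)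
    hence "\<lceil>ln (real (6 * N * (j + 1)))\<rceil> \<le> \<lceil>ln (real (6 * N * (k + 1)))\<rceil>"
      by (rule ceiling_mono)
    moreover have "G (3 * j + 2) \<le> G (3 * k + 2)"
      using \<open>j \<le> k\<close> by (intro monoD[OF G]) auto
    ultimately show "\<nu>1 j \<le> \<nu>1 k"
      by (simp only: tikh_nu1_def Let_def)
        (auto intro!: monoD[OF mono(2)] add_mono nat_mono)
  qed
  moreover have "c * (j + 1) - 1 \<le> c * (k + 1) - 1" for c :: nat
    using jk by (intro diff_le_mono mult_le_mono) auto
  ultimately show "\<nu>2 j \<le> \<nu>2 k"
    unfolding tikh_nu2_def by (intro max.mono monoD[OF mono(1)] monoD[of \<nu>1])
qed

text \<open>The point \<open>u\<close> replaces the fixed point of least norm. Its precision may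
  depend, through \<open>f\<close>, on the index from which its variational inequality
  holds.\<close>

lemma approx_projection:
  shows "\<exists>n\<le>tikh_psi N l b D B L k f. \<exists>u. norm (u - p) \<le> N \<and> norm (T u - u) \<le> 1 / (real (f n) + 1) \<and>
    (\<forall>j\<ge>n. u \<bullet> (u - y j) \<le> 1 / (4 * (real k + 1)))"
proof -
  define R where "R = 64 * N ^ 4 * (k + 1)\<^sup>2"
  \<comment> \<open>Precision required of \<open>u\<close> and \<open>y j\<close> so that their
    convex combinations fall into \<open>F m\<close>; the square makes up for the square root lost
    in \<open>approx_fixpoint_convex\<close>.\<close>
  define q where "q m = 48 * N * (m + 1)\<^sup>2" for m
  \<comment> \<open>The next precision must serve two purposes: admit convex combinations with
    \<open>y j\<close>, and meet the demand of \<open>f\<close> at the index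
    \<open>\<nu>2 (q m)\<close>.\<close>
  define c where "c m = max (f (\<nu>2 (q m))) (q m)" for m
  define F where "F m = {u. norm (u - p) \<le> N \<and> norm (T u - u) \<le> 1 / (real m + 1)}" for m
  define \<epsilon> where "\<epsilon> = 1 / (64 * (real N)\<^sup>2 * (real k + 1)\<^sup>2)"
  define r where "r i = (c ^^ i) 0" for i
  have "R > 0" using N_pos by (simp add: R_def)
  have "real R * \<epsilon> = (real N)\<^sup>2"
  proof -
    have "real R = (real N)\<^sup>2 * (64 * (real N)\<^sup>2 * (real k + 1)\<^sup>2)"
      by (simp add: R_def power2_eq_square power4_eq_xxxx algebra_simps)
    moreover have "64 * (real N)\<^sup>2 * (real k + 1)\<^sup>2 \<noteq> 0" using N_pos by simp
    ultimately show ?thesis by (simp add: \<epsilon>_def)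
  qed
  hence "(norm p)\<^sup>2 \<le> real R * \<epsilon>" using p(3) by (simp add: power_mono)
  moreover have "p \<in> F (r R)" by (simp add: F_def p)
  ultimately obtain i u where i: "i < R" and u: "u \<in> F (r (Suc i))"
    and min: "\<And>w. w \<in> F (r i) \<Longrightarrow> (norm u)\<^sup>2 \<le> (norm w)\<^sup>2 + \<epsilon>"
    using exists_approx_minimizer[of p F r R "\<lambda>u. (norm u)\<^sup>2" \<epsilon>] \<open>R > 0\<close> by auto
  define m where "m = r i"
  have Fmono: "F j \<subseteq> F j'" if "j' \<le> j" for j j'
  proof -
    have "1 / (real j + 1) \<le> 1 / (real j' + 1)" using that by (simp add: frac_le)
    thus ?thesis by (force simp: F_def)
  qed
  have rS: "r (Suc i) = c m" by (simp add: r_def m_def)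
  have uq: "u \<in> F (q m)" and uf: "u \<in> F (f (\<nu>2 (q m)))"
    using u Fmono[OF max.cobounded2] Fmono[OF max.cobounded1] unfolding rS c_def by blast+
  have c_ge: "m \<le> c m" for m
  proof -
    have "m \<le> (m + 1)\<^sup>2" by (simp add: power2_eq_square)
    also have "\<dots> \<le> q m" using N_pos by (simp add: q_def)
    finally show ?thesis by (simp add: c_def)
  qed
  \<comment> \<open>The stage \<open>i\<close> is not known, but the iterates increase, so
    \<open>r R\<close> gives a bound independent of \<open>i\<close>.\<close>
  have "mono r"
    by (rule mono_iff_le_Suc[THEN iffD2]) (simp add: r_def c_ge)
  hence "m \<le> r R" using i by (simp add: m_def monoD)
  hence "q m \<le> q (r R)" by (simp add: q_def power_mono)
  hence "\<nu>2 (q m) \<le> \<nu>2 (q (r R))" by (rule monoD[OF mono_\<nu>2])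
  also have "\<nu>2 (q (r R)) = tikh_psi N l b D B L k f"
    by (simp add: tikh_psi_def Let_def q_def r_def c_def[abs_def] R_def)
  finally have "\<nu>2 (q m) \<le> tikh_psi N l b D B L k f" .
  moreover have "norm (u - p) \<le> N" "norm (T u - u) \<le> 1 / (real (f (\<nu>2 (q m))) + 1)"
    using uf by (auto simp: F_def)
  moreover have "u \<bullet> (u - y j) \<le> 1 / (4 * (real k + 1))" if j: "j \<ge> \<nu>2 (q m)" for j
  proof -
    \<comment> \<open>Balances the two errors: \<open>t * (2 * N)\<^sup>2\<close> and
      \<open>\<epsilon> / t\<close> both equal \<open>1 / (4 * (k + 1))\<close>.\<close>
    define t where "t = 1 / (16 * (real N)\<^sup>2 * (real k + 1))"
    define w where "w = (1 - t) *\<^sub>R u + t *\<^sub>R y j"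
    define \<delta> where "\<delta> = 1 / (real (q m) + 1)"
    have "(real N)\<^sup>2 * (real k + 1) \<ge> 1 * 1" using N_pos by (intro mult_mono) auto
    hence "16 * (real N)\<^sup>2 * (real k + 1) \<ge> 1" by simp
    hence t: "0 < t" "t \<le> 1" unfolding t_def by (simp_all only: zero_less_divide_1_iff divide_le_eq_1) auto
    have d: "norm (u - y j) \<le> 2 * N" using uq y_ball by (intro ball_diam) (auto simp: F_def)
    have "w \<in> F m"
    proof -
      have "w - p = (1 - t) *\<^sub>R (u - p) + t *\<^sub>R (y j - p)" by (simp add: w_def algebra_simps)
      hence "norm (w - p) \<le> (1 - t) * norm (u - p) + t * norm (y j - p)"
        using norm_triangle_ineq[of "(1 - t) *\<^sub>R (u - p)" "t *\<^sub>R (y j - p)"] t by simp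
      also have "\<dots> \<le> (1 - t) * N + t * N"
        using t uq y_ball[of j] by (intro add_mono mult_left_mono) (auto simp: F_def)
      finally have "norm (w - p) \<le> N" by (simp add: algebra_simps)
      moreover have "norm (T w - w) \<le> 1 / (real m + 1)"
      proof (rule power2_le_imp_le)
        \<comment> \<open>The two terms are at most 1/24 and 1/48 of
          \<open>1 / (m + 1)\<^sup>2\<close>.\<close>
        have "(norm (T w - w))\<^sup>2 \<le> 2 * N * \<delta> + \<delta>\<^sup>2"
          unfolding w_def \<delta>_def using t uq approx_fixpoint_y[OF j] d
          by (intro approx_fixpoint_convex T) (auto simp: F_def)
        also have "\<delta> \<le> 1 / (48 * N * (real m + 1)\<^sup>2)"
          using N_pos by (simp add: \<delta>_def q_def frac_le add.commute)
        hence "2 * N * \<delta> \<le> 2 * N * (1 / (48 * N * (real m + 1)\<^sup>2))"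
          by (intro mult_left_mono) auto
        also have "\<dots> = 1 / 24 * (1 / (real m + 1)\<^sup>2)" using N_pos by simp
        also have "\<delta>\<^sup>2 \<le> 1 * \<delta>"
          unfolding power2_eq_square by (intro mult_right_mono) (auto simp: \<delta>_def)
        also have "\<delta> \<le> 1 / 48 * (1 / (real m + 1)\<^sup>2)"
        proof -
          have "48 * 1 * (real m + 1)\<^sup>2 \<le> 48 * N * (real m + 1)\<^sup>2"
            using N_pos by (intro mult_right_mono) auto
          moreover have "real (q m) = 48 * N * (real m + 1)\<^sup>2" by (simp add: q_def add.commute)
          ultimately have "48 * (real m + 1)\<^sup>2 \<le> real (q m) + 1" by linarith
          thus ?thesis by (simp add: \<delta>_def frac_le)
        qed
        finally have "(norm (T w - w))\<^sup>2 \<le> 1 / 24 * (1 / (real m + 1)\<^sup>2) + 1 / 48 * (1 / (real m + 1)\<^sup>2)"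
          by simp
        also have "\<dots> = 1 / 16 * (1 / (real m + 1)\<^sup>2)" by simp
        also have "\<dots> \<le> 1 * (1 / (real m + 1)\<^sup>2)" by (intro mult_right_mono) auto
        finally show "(norm (T w - w))\<^sup>2 \<le> (1 / (real m + 1))\<^sup>2" by (simp add: power_divide)
      qed auto
      ultimately show ?thesis by (simp add: F_def)
    qed
    hence "2 * (u \<bullet> (u - y j)) \<le> t * (2 * real N)\<^sup>2 + \<epsilon> / t"
      using min[of w] d t(1)
      by (intro approx_minimizer_variational) (auto simp: w_def m_def norm_minus_commute)
    also have "\<dots> = 1 / 2 * (1 / (real k + 1))"
    proof -
      define A where "A = real k + 1"
      have "A > 0" by (simp add: A_def)
      thus ?thesis unfolding t_def \<epsilon>_def A_def[symmetric]
        using N_pos by (simp add: power2_eq_square field_simps)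
    qed
    finally have "u \<bullet> (u - y j) \<le> 1 / 4 * (1 / (real k + 1))" by linarith
    thus ?thesis by simp
  qed
  ultimately show ?thesis by blast
qed

section \<open>Distance to the approximate projection and metastability\<close>

text \<open>As \<open>S n\<close> moves \<open>u\<close> by at most \<delta>,
  \<open>x (Suc n)\<close> is at most \<delta> farther from \<open>u\<close> than
  \<open>y n\<close>. On squaring, the cross term costs \<open>4 * N * \<delta>\<close>, and
  \<open>\<delta> * \<delta> \<le> \<delta>\<close> accounts for the remaining 1.\<close>

lemma dist_step:
  fixes \<delta> :: real
  assumes u: "norm (u - p) \<le> N" and \<delta>: "norm (T u - u) \<le> \<delta>" "\<delta> \<le> 1"
    and c: "u \<bullet> (u - y n) \<le> c"
  shows "(norm (x (Suc n) - u))\<^sup>2 \<le> \<beta> n * (norm (x n - u))\<^sup>2 + (1 - \<beta> n) * (2 * c) + (4 * real N + 1) * \<delta>"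
proof -
  have \<delta>0: "\<delta> \<ge> 0" using norm_ge_zero \<delta>(1) by (rule order_trans)
  have "lam n * norm (T u - u) \<le> 1 * \<delta>"
    using \<delta> \<delta>0 lam_le[of n] lam_pos[of n] by (intro mult_mono) auto
  hence "norm (S n u - u) \<le> \<delta>" using lam_pos[of n] by (simp add: S_minus)
  hence "norm (x (Suc n) - u) \<le> norm (y n - u) + \<delta>"
    using norm_triangle_ineq[of "S n (y n) - S n u" "S n u - u"] S_nonexpansive[of n "y n" u]
    by (simp add: x_Suc_S)
  hence "(norm (x (Suc n) - u))\<^sup>2 \<le> (norm (y n - u) + \<delta>)\<^sup>2" by (intro power_mono) auto
  also have "\<dots> = (norm (y n - u))\<^sup>2 + (2 * norm (y n - u)) * \<delta> + \<delta> * \<delta>"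
    by (simp add: power2_eq_square algebra_simps)
  also have "(2 * norm (y n - u)) * \<delta> \<le> (2 * (2 * N)) * \<delta>"
    using ball_diam[OF y_ball u, of n] \<delta>0 by (intro mult_right_mono) auto
  also have "\<delta> * \<delta> \<le> 1 * \<delta>" using \<delta> \<delta>0 by (intro mult_right_mono) auto
  also have "(norm (y n - u))\<^sup>2 \<le> \<beta> n * (norm (x n - u))\<^sup>2 + (1 - \<beta> n) * (2 * c)"
  proof -
    \<comment> \<open>Obtained by squaring \<open>\<beta> n *\<^sub>R (x n - u) = (y n - u) + (1 -
      \<beta> n) *\<^sub>R u\<close>; the last square is then dropped.\<close>
    have "(norm (y n - u))\<^sup>2 = (\<beta> n)\<^sup>2 * (norm (x n - u))\<^sup>2
        + 2 * (1 - \<beta> n) * (u \<bullet> (u - y n)) - (norm ((1 - \<beta> n) *\<^sub>R u))\<^sup>2"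
      unfolding power2_norm_eq_inner
      by (simp add: inner_diff_left inner_diff_right inner_commute algebra_simps power2_eq_square)
    moreover have "(\<beta> n)\<^sup>2 * (norm (x n - u))\<^sup>2 \<le> \<beta> n * (norm (x n - u))\<^sup>2"
      using \<beta>_pos[of n] \<beta>_le[of n]
      by (intro mult_right_mono) (auto simp: power2_eq_square mult_left_le)
    moreover have "2 * (1 - \<beta> n) * (u \<bullet> (u - y n)) \<le> 2 * (1 - \<beta> n) * c"
      using c \<beta>_le[of n] by (intro mult_left_mono) auto
    moreover have "2 * (1 - \<beta> n) * c = (1 - \<beta> n) * (2 * c)" by simp
    ultimately show ?thesis using zero_le_power2[of "norm ((1 - \<beta> n) *\<^sub>R u)"] by linarith
  qed
  finally show ?thesis by (simp add: algebra_simps)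
qed

text \<open>The recursion of \<open>dist_step\<close> is solved by \<open>xu_inequality\<close>. The
  shares of the target are 4/27 for the damped start, 1/24 for the variational term and 1/3 for the
  errors. The errors grow linearly in \<open>q\<close>, so \<delta> has to be tuned to the length of
  the interval.\<close>

lemma dist_le:
  fixes \<delta> :: real
  assumes u: "norm (u - p) \<le> N"
    and \<delta>: "norm (T u - u) \<le> \<delta>" "\<delta> \<le> 1" "real q * ((4 * real N + 1) * \<delta>) \<le> 1 / (3 * (real k + 1))"
    and var: "\<And>j. j \<ge> n \<Longrightarrow> u \<bullet> (u - y j) \<le> 1 / (48 * (real k + 1))"
    and q: "q \<ge> tikh_sigma N D k n"
  shows "(norm (x q - u))\<^sup>2 \<le> 1 / (real k + 1)"
proof -
  define K where "K = real (27 * N\<^sup>2 * (k + 1))"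
  have "1 \<le> 27 * N\<^sup>2 * (k + 1)" using N_pos by (simp add: Suc_le_eq)
  hence K: "K \<ge> 1" unfolding K_def by (metis of_nat_mono of_nat_1)
  \<comment> \<open>The final \<open>+ 1\<close> in \<open>tikh_sigma\<close> makes \<open>q\<close>
    a successor: the product up to \<open>q\<close> is that of \<open>prod_\<beta>_le\<close> at
    \<open>q'\<close> times \<open>\<beta> n \<le> 1\<close>.\<close>
  obtain q' where q': "q = Suc q'" "q' \<ge> D (n + nat \<lceil>ln K\<rceil>)"
    using q by (cases q) (auto simp: tikh_sigma_def K_def)
  note P = prod_\<beta>_le[OF K q'(2)]
  have \<delta>0: "\<delta> \<ge> 0" using norm_ge_zero \<delta>(1) by (rule order_trans)
  have "(norm (x q - u))\<^sup>2 \<le> (\<Prod>i=n..<q. \<beta> i) * (norm (x n - u))\<^sup>2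
      + 2 * (1 / (48 * (real k + 1))) + (\<Sum>i=n..<q. (4 * real N + 1) * \<delta>)"
    by (rule xu_inequality[where s = "\<lambda>i. (norm (x i - u))\<^sup>2"])
      (use P(1) q'(1) \<beta>_le \<delta>0 dist_step[OF u \<delta>(1,2) var] in \<open>auto simp: less_imp_le[OF \<beta>_pos]\<close>)
  also have "(\<Prod>i=n..<q. \<beta> i) = \<beta> n * (\<Prod>i=Suc n..<Suc q'. \<beta> i)"
    using P(1) by (simp add: q'(1) prod.atLeast_Suc_lessThan del: prod.op_ivl_Suc)
  also have "\<dots> \<le> 1 * (1 / K)"
    by (intro mult_mono P(2) \<beta>_le prod_nonneg) (auto simp: less_imp_le[OF \<beta>_pos])
  hence "\<beta> n * (\<Prod>i=Suc n..<Suc q'. \<beta> i) * (norm (x n - u))\<^sup>2 \<le> 1 / K * (2 * N)\<^sup>2"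
    using K power_mono[OF ball_diam[OF x_ball u, of n], of 2] by (intro mult_mono) auto
  also have "1 / K * (2 * N)\<^sup>2 = 4 / 27 * (1 / (real k + 1))"
  proof -
    have "K = 27 * ((real N)\<^sup>2 * (real k + 1))" by (simp add: K_def algebra_simps)
    thus ?thesis using N_pos by (simp add: power_mult_distrib del: distrib_left_numeral)
  qed
  also have "(\<Sum>i=n..<q. (4 * real N + 1) * \<delta>) \<le> real q * ((4 * real N + 1) * \<delta>)"
    using \<delta>0 by (simp add: mult_right_mono)
  also note \<delta>(3)
  finally have "(norm (x q - u))\<^sup>2
      \<le> 4 / 27 * (1 / (real k + 1)) + 2 * (1 / (48 * (real k + 1))) + 1 / (3 * (real k + 1))"
    by simp
  also have "\<dots> = (4 / 27 + 1 / 24 + 1 / 3) * (1 / (real k + 1))"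
  proof -
    define A where "A = real k + 1"
    have "A > 0" by (simp add: A_def)
    thus ?thesis unfolding A_def[symmetric] by (simp add: field_simps)
  qed
  also have "\<dots> \<le> 1 * (1 / (real k + 1))" by (intro mult_right_mono) auto
  finally show ?thesis by simp
qed

lemma metastability:
  assumes h: "\<And>n. h n > 0"
  shows "\<exists>n\<le>tikh_mu N l b h D B L k f. \<forall>i\<in>{n..f n}. \<forall>j\<in>{n..f n}. norm (x i - x j) \<le> 1 / (real k + 1)"
proof -
  \<comment> \<open>Makes \<open>1 / (k' + 1)\<close> the square of
    \<open>1 / (2 * (k + 1))\<close>, half the target for the triangle inequality.\<close>
  define k' where "k' = 4 * (k + 1)\<^sup>2 - 1"
  have k': "real k' + 1 = 4 * (real k + 1)\<^sup>2"
    unfolding k'_def by (subst of_nat_diff) (auto simp: add.commute)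
  define n1 where "n1 = b (54 * N\<^sup>2 * (k' + 1) - 1)"
  define s where "s m = tikh_sigma N D k' (max m n1)" for m
  \<comment> \<open>The interval starts at \<open>s m\<close> and ends at \<open>f (s m)\<close>, so
    the precision demanded of \<open>u\<close> must outweigh the errors of that many steps.\<close>
  define Q where "Q m = 3 * (10 * N + 1) * (k' + 1) * (f (s m) + 1) * h (f (s m))" for m
  \<comment> \<open>The argument \<open>12 * (k' + 1) - 1\<close> turns the factor 4 of
    \<open>approx_projection\<close> into the 48 of \<open>dist_le\<close>.\<close>
  obtain m u where m: "m \<le> tikh_psi N l b D B L (12 * (k' + 1) - 1) (\<lambda>m. Q m - 1)"
    and u: "norm (u - p) \<le> N" and fixu: "norm (T u - u) \<le> 1 / (real (Q m - 1) + 1)"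
    and var: "\<And>j. j \<ge> m \<Longrightarrow> u \<bullet> (u - y j) \<le> 1 / (4 * (real (12 * (k' + 1) - 1) + 1))"
    using approx_projection[of "12 * (k' + 1) - 1" "\<lambda>m. Q m - 1"] by blast
  define \<delta> where "\<delta> = 1 / real (Q m)"
  have Q: "Q m > 0" using h by (simp add: Q_def)
  have \<delta>: "norm (T u - u) \<le> \<delta>" "\<delta> \<le> 1"
    using fixu Q by (simp_all add: \<delta>_def Suc_le_eq)
  have tikh: "tikh_mu N l b h D B L k f
      = s (tikh_psi N l b D B L (12 * (k' + 1) - 1) (\<lambda>m. Q m - 1))"
    unfolding tikh_mu_def Let_def k'_def[symmetric] n1_def[symmetric] s_def[symmetric] Q_def[symmetric] ..
  have "s m \<le> tikh_mu N l b h D B L k f"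
    unfolding tikh s_def tikh_sigma_def using m by (auto intro!: monoD[OF mono(2)])
  moreover have close: "norm (x q - u) \<le> 1 / (2 * (real k + 1))" if q: "q \<in> {s m..f (s m)}" for q
  proof (rule power2_le_imp_le)
    have "(norm (x q - u))\<^sup>2 \<le> 1 / (real k' + 1)"
    proof (rule dist_le[OF u \<delta>])
      have "real q * (4 * N + 1) * (3 * (real k' + 1)) \<le> Q m"
      proof -
        \<comment> \<open>Compared factor by factor with \<open>Q m\<close>:
          \<open>q \<le> f (s m)\<close>, \<open>4 * N + 1 \<le> 10 * N + 1\<close>, and
          \<open>h\<close> is at least 1.\<close>
        have "(q * (4 * N + 1)) * (3 * (k' + 1)) * 1
            \<le> ((f (s m) + 1) * (10 * N + 1)) * (3 * (k' + 1)) * h (f (s m))"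
          using q h by (intro mult_mono) (auto simp: Suc_le_eq)
        also have "\<dots> = Q m" by (simp only: Q_def mult_ac)
        finally have "real ((q * (4 * N + 1)) * (3 * (k' + 1)) * 1) \<le> real (Q m)"
          by (rule of_nat_mono)
        thus ?thesis by (simp add: algebra_simps)
      qed
      thus "real q * ((4 * real N + 1) * \<delta>) \<le> 1 / (3 * (real k' + 1))"
        using Q by (simp add: \<delta>_def field_simps)
      show "u \<bullet> (u - y j) \<le> 1 / (48 * (real k' + 1))" if "j \<ge> max m n1" for j
        using var[of j] that by (simp add: algebra_simps)
      show "tikh_sigma N D k' (max m n1) \<le> q" using q by (simp add: s_def)
    qed
    thus "(norm (x q - u))\<^sup>2 \<le> (1 / (2 * (real k + 1)))\<^sup>2"
      by (simp add: k' power_divide power_mult_distrib del: distrib_left_numeral)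
  qed auto
  have "norm (x i - x j) \<le> 1 / (real k + 1)" if "i \<in> {s m..f (s m)}" "j \<in> {s m..f (s m)}" for i j
  proof -
    have "norm (x i - x j) \<le> norm (x i - u) + norm (x j - u)"
      using norm_triangle_ineq4[of "x i - u" "x j - u"] by simp
    also have "\<dots> \<le> 1 / (2 * (real k + 1)) + 1 / (2 * (real k + 1))"
      by (intro add_mono close that)
    finally show ?thesis by (simp add: field_simps)
  qed
  ultimately show ?thesis by blast
qed

end

theorem theorem3p5:
  fixes T :: "'a::{real_inner, complete_space} \<Rightarrow> 'a"
    and \<beta> lam :: "nat \<Rightarrow> real"
    and x :: "nat \<Rightarrow> 'a"
    and N l :: nat
    and b h D B L :: "nat \<Rightarrow> nat"
  assumes nonexpansive: "\<forall>u v. norm (T u - T v) \<le> norm (u - v)"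
    and beta_range: "\<forall>n. \<beta> n \<in> {0<..1}"
    and lam_range: "\<forall>n. lam n \<in> {0<..1}"
    and iteration: "\<forall>n. x (Suc n) = \<beta> n *\<^sub>R x n + lam n *\<^sub>R (T (\<beta> n *\<^sub>R x n) - \<beta> n *\<^sub>R x n)"
    and l_pos: "l \<noteq> 0"
    and monotone_moduli: "mono b" "mono D" "mono B" "mono L" "mono h"
    and h_pos: "\<forall>n. h n \<noteq> 0"
    and Q1: "\<forall>n. \<beta> n \<ge> 1 / real (h n)"
    and Q2: "\<forall>k. \<forall>n\<ge>b k. \<bar>1 - \<beta> n\<bar> \<le> 1 / (real k + 1)"
    and Q3: "\<forall>k. (\<Sum>i=1..D k. 1 - \<beta> i) \<ge> real k"
    and Q4: "\<forall>k n. (\<Sum>i=B k + 1..B k + n. \<bar>\<beta> i - \<beta> (i - 1)\<bar>) \<le> 1 / (real k + 1)"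
    and Q5: "\<forall>n. lam n \<ge> 1 / real l"
    and Q6: "\<forall>k n. (\<Sum>i=L k + 1..L k + n. \<bar>lam i - lam (i - 1)\<bar>) \<le> 1 / (real k + 1)"
    and N_pos: "N \<noteq> 0"
    and N_bound: "\<exists>p\<in>Fix T. real N \<ge> max (norm (x 0 - p)) (norm p)"
  shows "\<forall>k. \<forall>f :: nat \<Rightarrow> nat. mono f \<longrightarrow>
    (\<exists>n\<le>tikh_mu N l b h D B L k f. \<forall>i\<in>{n..f n}. \<forall>j\<in>{n..f n}.
        norm (x i - x j) \<le> 1 / (real k + 1))"
proof -
  obtain p where "T p = p" "norm (x 0 - p) \<le> N" "norm p \<le> N"
    using N_bound by (auto simp: Fix_def)
  \<comment> \<open>The locale states the convergence of \<beta> to 1 one-sidedly, whence the rule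
    \<open>abs_ge_self\<close>.\<close>
  then interpret tikhonov_mann T \<beta> lam x p N l b D B L
    using assms by unfold_locales (auto intro: order_trans[OF abs_ge_self])
  show ?thesis using metastability[of h] h_pos by blast
qed

end
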